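(* Let $(\overline{M},\overline{g})$ be a Lorentzian manifold and $M$ a compact null hypersurface in $\overline{M}$ with trivial first De Rham cohomology group $H^{1}(M,\mathbb{R})$. Then $M$ admits no closed normalization, i.e. there is no closed rigging for $M$.
   Context: A null hypersurface $M$ in a Lorentzian manifold $(\overline{M},\overline{g})$ is a smooth codimension-one submanifold such that the restriction of $\overline{g}$ to $T_pM$ is degenerate for every $p\in M$. A rigging for $M$ is a vector field $\zeta$ defined on some open set of $\overline{M}$ containing $M$ such that $\zeta_p\notin T_pM$ for each $p\in M$; the pair $(M,\zeta)$ is then called a normalization of $M$. The normalization (or the rigging) is closed if the $1$-form $\alpha=\overline{g}(\zeta,\cdot)$ is closed. *)

theory Defs
  imports "HOL-Analysis.Analysis"
begin

section \<open>Smooth functions between Euclidean spaces\<close>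

(* The set S is meant to be open.  Continuity at every order of iterated directional derivatives
   is equivalent to the usual C^k condition in finite dimension. *)
primrec Ck_on :: "nat \<Rightarrow> ('e::euclidean_space \<Rightarrow> 'f::euclidean_space) \<Rightarrow> 'e set \<Rightarrow> bool" where
  "Ck_on 0 f S \<longleftrightarrow> continuous_on S f"
| "Ck_on (Suc k) f S \<longleftrightarrow>
     (\<forall>x\<in>S. f differentiable (at x)) \<and> (\<forall>v. Ck_on k (\<lambda>x. frechet_derivative f (at x) v) S)"

definition smooth_on :: "'e::euclidean_space set \<Rightarrow> ('e \<Rightarrow> 'f::euclidean_space) \<Rightarrow> bool" where
  "smooth_on S f \<longleftrightarrow> (\<forall>k. Ck_on k f S)"


section \<open>Smooth manifolds\<close>

(* A chart is a pair (U, phi) of a domain and a coordinate map; only the values of phi on U matter. *)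
type_synonym ('a, 'e) chart = "'a set \<times> ('a \<Rightarrow> 'e)"

definition chart_inv :: "('a, 'e) chart \<Rightarrow> 'e \<Rightarrow> 'a" where
  "chart_inv c = inv_into (fst c) (snd c)"

definition is_chart :: "'a topology \<Rightarrow> ('a, 'e::euclidean_space) chart \<Rightarrow> bool" where
  "is_chart X c \<longleftrightarrow> openin X (fst c) \<and> open (snd c ` fst c) \<and>
     homeomorphic_map (subtopology X (fst c)) (top_of_set (snd c ` fst c)) (snd c)"

(* The atlas need not be maximal: all notions below depend only on the smooth structure it
   generates. *)
definition smooth_manifold :: "'a topology \<Rightarrow> ('a, 'e::euclidean_space) chart set \<Rightarrow> bool" where
  "smooth_manifold X A \<longleftrightarrow>
     Hausdorff_space X \<and> second_countable X \<and>
     (\<forall>c\<in>A. is_chart X c) \<and> (\<Union>c\<in>A. fst c) = topspace X \<and>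
     (\<forall>c\<in>A. \<forall>d\<in>A. smooth_on (snd c ` (fst c \<inter> fst d)) (snd d \<circ> chart_inv c))"

(* An arbitrary chart around p; used only where the result does not depend on the choice. *)
definition chart_at :: "('a, 'e) chart set \<Rightarrow> 'a \<Rightarrow> ('a, 'e) chart" where
  "chart_at A p = (SOME c. c \<in> A \<and> p \<in> fst c)"

definition smooth_function ::
    "'a topology \<Rightarrow> ('a, 'e::euclidean_space) chart set \<Rightarrow> ('a \<Rightarrow> real) \<Rightarrow> bool" where
  "smooth_function X A f \<longleftrightarrow> (\<forall>c\<in>A. smooth_on (snd c ` fst c) (f \<circ> chart_inv c))"

definition smooth_map ::
    "'a topology \<Rightarrow> ('a, 'e::euclidean_space) chart set \<Rightarrow>
     'b topology \<Rightarrow> ('b, 'f::euclidean_space) chart set \<Rightarrow> ('a \<Rightarrow> 'b) \<Rightarrow> bool" where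
  "smooth_map X A Y B F \<longleftrightarrow> continuous_map X Y F \<and>
     (\<forall>c\<in>A. \<forall>d\<in>B. smooth_on (snd c ` {p \<in> fst c. F p \<in> fst d}) (snd d \<circ> F \<circ> chart_inv c))"


section \<open>Tangent vectors\<close>

(* A tangent vector at p assigns to every chart of the atlas around p its component vector in that
   chart, components in different charts being related by the derivative of the transition map.
   The components in charts not containing p are set to 0, so that equality of tangent vectors is
   equality of functions. *)
type_synonym ('a, 'e) tvec = "('a, 'e) chart \<Rightarrow> 'e"

definition tangent_space ::
    "('a, 'e::euclidean_space) chart set \<Rightarrow> 'a \<Rightarrow> ('a, 'e) tvec set" where
  "tangent_space A p = {v.
     (\<forall>c. \<not> (c \<in> A \<and> p \<in> fst c) \<longrightarrow> v c = 0) \<and>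
     (\<forall>c\<in>A. \<forall>d\<in>A. p \<in> fst c \<and> p \<in> fst d \<longrightarrow>
        v d = frechet_derivative (snd d \<circ> chart_inv c) (at (snd c p)) (v c))}"

definition tzero :: "('a, 'e::euclidean_space) tvec" where
  "tzero = (\<lambda>c. 0)"

definition tlincomb ::
    "real \<Rightarrow> ('a, 'e::euclidean_space) tvec \<Rightarrow> real \<Rightarrow> ('a, 'e) tvec \<Rightarrow> ('a, 'e) tvec" where
  "tlincomb a v b w = (\<lambda>c. a *\<^sub>R v c + b *\<^sub>R w c)"

definition linear_on_tangent ::
    "('a, 'e::euclidean_space) chart set \<Rightarrow> 'a \<Rightarrow> (('a, 'e) tvec \<Rightarrow> real) \<Rightarrow> bool" where
  "linear_on_tangent A p h \<longleftrightarrow>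
     (\<forall>v\<in>tangent_space A p. \<forall>w\<in>tangent_space A p. \<forall>a b. h (tlincomb a v b w) = a * h v + b * h w)"

(* The tangent vector at p whose component in the chart c is w; for w = e_i this is the
   coordinate vector d/dx^i at p. *)
definition coord_vec ::
    "('a, 'e::euclidean_space) chart set \<Rightarrow> ('a, 'e) chart \<Rightarrow> 'a \<Rightarrow> 'e \<Rightarrow> ('a, 'e) tvec" where
  "coord_vec A c p w = (\<lambda>d. if d \<in> A \<and> p \<in> fst d
     then frechet_derivative (snd d \<circ> chart_inv c) (at (snd c p)) w else 0)"

definition map_differential ::
    "('a, 'e::euclidean_space) chart set \<Rightarrow> ('b, 'f::euclidean_space) chart set \<Rightarrow>
     ('a \<Rightarrow> 'b) \<Rightarrow> 'a \<Rightarrow> ('a, 'e) tvec \<Rightarrow> ('b, 'f) tvec" where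
  "map_differential A B F p v = (let c = chart_at A p in
     (\<lambda>d. if d \<in> B \<and> F p \<in> fst d
        then frechet_derivative (snd d \<circ> F \<circ> chart_inv c) (at (snd c p)) (v c) else 0))"

definition smooth_vector_field_on ::
    "('a, 'e::euclidean_space) chart set \<Rightarrow> 'a set \<Rightarrow> ('a \<Rightarrow> ('a, 'e) tvec) \<Rightarrow> bool" where
  "smooth_vector_field_on A W V \<longleftrightarrow>
     (\<forall>p\<in>W. V p \<in> tangent_space A p) \<and>
     (\<forall>c\<in>A. smooth_on (snd c ` (fst c \<inter> W)) (\<lambda>x. V (chart_inv c x) c))"


section \<open>One-forms and the first de Rham cohomology\<close>

type_synonym ('a, 'e) form1 = "'a \<Rightarrow> ('a, 'e) tvec \<Rightarrow> real"

definition form_comp ::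
    "('a, 'e::euclidean_space) chart set \<Rightarrow> ('a, 'e) form1 \<Rightarrow> ('a, 'e) chart \<Rightarrow> 'e \<Rightarrow> 'e \<Rightarrow> real" where
  "form_comp A \<omega> c x w = \<omega> (chart_inv c x) (coord_vec A c (chart_inv c x) w)"

(* Smooth one-forms on the open set W.  They are required to vanish outside their proper domain, so
   that equality of one-forms is equality of functions. *)
definition one_forms_on ::
    "('a, 'e::euclidean_space) chart set \<Rightarrow> 'a set \<Rightarrow> ('a, 'e) form1 set" where
  "one_forms_on A W = {\<omega>.
     (\<forall>p v. \<not> (p \<in> W \<and> v \<in> tangent_space A p) \<longrightarrow> \<omega> p v = 0) \<and>
     (\<forall>p\<in>W. linear_on_tangent A p (\<omega> p)) \<and>
     (\<forall>c\<in>A. \<forall>w. smooth_on (snd c ` (fst c \<inter> W)) (\<lambda>x. form_comp A \<omega> c x w))}"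

(* In coordinates, (d omega)_ij = d_i omega_j - d_j omega_i. *)
definition ext_deriv_comp ::
    "('a, 'e::euclidean_space) chart set \<Rightarrow> ('a, 'e) form1 \<Rightarrow> ('a, 'e) chart \<Rightarrow>
     'e \<Rightarrow> 'e \<Rightarrow> 'e \<Rightarrow> real" where
  "ext_deriv_comp A \<omega> c x v w =
     frechet_derivative (\<lambda>y. form_comp A \<omega> c y w) (at x) v -
     frechet_derivative (\<lambda>y. form_comp A \<omega> c y v) (at x) w"

definition closed_one_forms_on ::
    "('a, 'e::euclidean_space) chart set \<Rightarrow> 'a set \<Rightarrow> ('a, 'e) form1 set" where
  "closed_one_forms_on A W = {\<omega> \<in> one_forms_on A W.
     \<forall>c\<in>A. \<forall>x\<in>snd c ` (fst c \<inter> W). \<forall>v w. ext_deriv_comp A \<omega> c x v w = 0}"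

definition function_differential ::
    "'a topology \<Rightarrow> ('a, 'e::euclidean_space) chart set \<Rightarrow> ('a \<Rightarrow> real) \<Rightarrow> ('a, 'e) form1" where
  "function_differential X A f = (\<lambda>p v.
     if p \<in> topspace X \<and> v \<in> tangent_space A p
     then let c = chart_at A p in frechet_derivative (f \<circ> chart_inv c) (at (snd c p)) (v c)
     else 0)"

definition exact_one_forms ::
    "'a topology \<Rightarrow> ('a, 'e::euclidean_space) chart set \<Rightarrow> ('a, 'e) form1 set" where
  "exact_one_forms X A = function_differential X A ` {f. smooth_function X A f}"

definition deRham_H1 ::
    "'a topology \<Rightarrow> ('a, 'e::euclidean_space) chart set \<Rightarrow> ('a, 'e) form1 set set" where
  "deRham_H1 X A = (let Z = closed_one_forms_on A (topspace X) in
     Z // {(\<omega>, \<eta>). \<omega> \<in> Z \<and> \<eta> \<in> Z \<and> (\<lambda>p v. \<omega> p v - \<eta> p v) \<in> exact_one_forms X A})"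

(* The zero element of H^1 is the class of the zero form, i.e. the set of exact forms. *)
definition trivial_deRham_H1 ::
    "'a topology \<Rightarrow> ('a, 'e::euclidean_space) chart set \<Rightarrow> bool" where
  "trivial_deRham_H1 X A \<longleftrightarrow> deRham_H1 X A = {exact_one_forms X A}"


section \<open>Lorentzian manifolds\<close>

type_synonym ('a, 'e) metric = "'a \<Rightarrow> ('a, 'e) tvec \<Rightarrow> ('a, 'e) tvec \<Rightarrow> real"

(* The values of g p are only relevant on the tangent space at p.  The signature condition
   (-,+,...,+) asks for an orthonormal frame; DIM('e) many such vectors automatically form a basis
   of the tangent space. *)
definition lorentzian_metric ::
    "'a topology \<Rightarrow> ('a, 'e::euclidean_space) chart set \<Rightarrow> ('a, 'e) metric \<Rightarrow> bool" where
  "lorentzian_metric X A g \<longleftrightarrow>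
     (\<forall>p\<in>topspace X.
        (\<forall>v\<in>tangent_space A p. linear_on_tangent A p (g p v)) \<and>
        (\<forall>v\<in>tangent_space A p. \<forall>w\<in>tangent_space A p. g p v w = g p w v) \<and>
        (\<exists>E. \<exists>t\<in>Basis. (\<forall>i\<in>Basis. E i \<in> tangent_space A p) \<and>
           (\<forall>i\<in>(Basis :: 'e set). \<forall>j\<in>Basis.
              g p (E i) (E j) = (if i \<noteq> j then 0 else if i = t then -1 else 1)))) \<and>
     (\<forall>c\<in>A. \<forall>v w. smooth_on (snd c ` fst c)
        (\<lambda>x. g (chart_inv c x) (coord_vec A c (chart_inv c x) v) (coord_vec A c (chart_inv c x) w)))"

definition lorentzian_manifold ::
    "'a topology \<Rightarrow> ('a, 'e::euclidean_space) chart set \<Rightarrow> ('a, 'e) metric \<Rightarrow> bool" where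
  "lorentzian_manifold X A g \<longleftrightarrow> smooth_manifold X A \<and> lorentzian_metric X A g"


section \<open>Null hypersurfaces and riggings\<close>

(* M is a subset of the ambient manifold (X, A), with the subspace topology and an atlas B of its
   own, such that the inclusion is a smooth immersion. *)
definition hypersurface ::
    "'a topology \<Rightarrow> ('a, 'e::euclidean_space) chart set \<Rightarrow>
     'a set \<Rightarrow> ('a, 'f::euclidean_space) chart set \<Rightarrow> bool" where
  "hypersurface X A M B \<longleftrightarrow>
     DIM('e) = DIM('f) + 1 \<and> M \<subseteq> topspace X \<and>
     smooth_manifold (subtopology X M) B \<and>
     smooth_map (subtopology X M) B X A (\<lambda>p. p) \<and>
     (\<forall>p\<in>M. inj_on (map_differential B A (\<lambda>p. p) p) (tangent_space B p))"

(* T_p M as a subspace of the ambient tangent space. *)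
definition sub_tangent_space ::
    "('a, 'e::euclidean_space) chart set \<Rightarrow> ('a, 'f::euclidean_space) chart set \<Rightarrow>
     'a \<Rightarrow> ('a, 'e) tvec set" where
  "sub_tangent_space A B p = map_differential B A (\<lambda>p. p) p ` tangent_space B p"

definition null_hypersurface ::
    "'a topology \<Rightarrow> ('a, 'e::euclidean_space) chart set \<Rightarrow> ('a, 'e) metric \<Rightarrow>
     'a set \<Rightarrow> ('a, 'f::euclidean_space) chart set \<Rightarrow> bool" where
  "null_hypersurface X A g M B \<longleftrightarrow> hypersurface X A M B \<and>
     (\<forall>p\<in>M. \<exists>v\<in>sub_tangent_space A B p. v \<noteq> tzero \<and> (\<forall>w\<in>sub_tangent_space A B p. g p v w = 0))"

(* zeta is a rigging for M defined on the open set W. *)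
definition rigging ::
    "'a topology \<Rightarrow> ('a, 'e::euclidean_space) chart set \<Rightarrow>
     'a set \<Rightarrow> ('a, 'f::euclidean_space) chart set \<Rightarrow> 'a set \<Rightarrow> ('a \<Rightarrow> ('a, 'e) tvec) \<Rightarrow> bool" where
  "rigging X A M B W \<zeta> \<longleftrightarrow> openin X W \<and> M \<subseteq> W \<and> smooth_vector_field_on A W \<zeta> \<and>
     (\<forall>p\<in>M. \<zeta> p \<notin> sub_tangent_space A B p)"

definition metric_dual_form ::
    "('a, 'e::euclidean_space) chart set \<Rightarrow> ('a, 'e) metric \<Rightarrow> 'a set \<Rightarrow>
     ('a \<Rightarrow> ('a, 'e) tvec) \<Rightarrow> ('a, 'e) form1" where
  "metric_dual_form A g W \<zeta> = (\<lambda>p v.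
     if p \<in> W \<and> v \<in> tangent_space A p then g p (\<zeta> p) v else 0)"

definition closed_rigging ::
    "'a topology \<Rightarrow> ('a, 'e::euclidean_space) chart set \<Rightarrow> ('a, 'e) metric \<Rightarrow>
     'a set \<Rightarrow> ('a, 'f::euclidean_space) chart set \<Rightarrow> 'a set \<Rightarrow> ('a \<Rightarrow> ('a, 'e) tvec) \<Rightarrow> bool" where
  "closed_rigging X A g M B W \<zeta> \<longleftrightarrow> rigging X A M B W \<zeta> \<and>
     metric_dual_form A g W \<zeta> \<in> closed_one_forms_on A W"

end

theory Submission
  imports Defs
begin

text \<open>
  Suppose that \<open>\<zeta>\<close> is a closed rigging, with dual form \<open>\<alpha> = g(\<zeta>, \<cdot>)\<close>. The pullback of \<open>\<alpha>\<close> to \<open>M\<close> is closed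
  (\<open>pullback_in_closed_one_forms\<close>), hence the differential of a smooth function, since \<open>H\<^sup>1(M)\<close>
  is trivial. As \<open>M\<close> is compact and nonempty, that function has a maximum, at a point \<open>p\<close> say, where its
  differential vanishes (\<open>closed_one_form_vanishes_somewhere\<close>). So \<open>\<zeta>\<close> is orthogonal to \<open>T\<^sub>pM\<close>.

  By degeneracy there is a nonzero \<open>v \<in> T\<^sub>pM\<close> that is orthogonal to \<open>T\<^sub>pM\<close>, and by the above \<open>v\<close> is also
  orthogonal to \<open>\<zeta>\<close>. But \<open>T\<^sub>pM\<close> is a hyperplane that does not contain \<open>\<zeta>\<close>, so the two
  span the ambient tangent space (\<open>transverse_to_hypersurface_spans\<close>), and \<open>v\<close> is orthogonal to everything.
  This contradicts the nondegeneracy of the Lorentzian metric (\<open>lorentzian_metric_nondegenerate\<close>).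

  Most of the work is in the closedness of the pullback. In coordinates it amounts to the chain rule,
  together with the symmetry of second derivatives (\<open>mixed_derivatives_commute\<close>).
\<close>

section \<open>Calculus of \<open>C\<^sup>k\<close> maps\<close>

lemma Ck_on_cong:
  assumes "open S" "\<And>x. x \<in> S \<Longrightarrow> f x = g x"
  shows "Ck_on k f S \<longleftrightarrow> Ck_on k g S"
  using assms(2)
proof (induction k arbitrary: f g)
  case 0
  then show ?case by (simp cong: continuous_on_cong)
next
  case (Suc k)
  have d: "f differentiable (at x) \<longleftrightarrow> g differentiable (at x)" if "x \<in> S" for x
    using has_derivative_transform_within_open[OF _ \<open>open S\<close> that] Suc.prems
    unfolding differentiable_def by metis
  have fd: "frechet_derivative f (at x) = frechet_derivative g (at x)"
    if "x \<in> S" "f differentiable (at x)" for x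
    using frechet_derivative_transform_within_open[OF that(2) \<open>open S\<close> that(1)] Suc.prems by blast
  show ?case
  proof (cases "\<forall>x\<in>S. f differentiable (at x)")
    case True
    then have "Ck_on k (\<lambda>x. frechet_derivative f (at x) v) S \<longleftrightarrow>
        Ck_on k (\<lambda>x. frechet_derivative g (at x) v) S" for v
      using fd by (intro Suc.IH) auto
    then show ?thesis using d by auto
  next
    case False
    then show ?thesis using d by auto
  qed
qed

lemma Ck_on_Suc_imp: "Ck_on (Suc k) f S \<Longrightarrow> Ck_on k f S"
proof (induction k arbitrary: f)
  case 0
  have "continuous (at x within S) f" if "x \<in> S" for x
    using 0 that by (simp add: continuous_at_imp_continuous_at_within differentiable_imp_continuous_within)
  then show ?case by (simp add: continuous_on_eq_continuous_within)
next
  case (Suc k)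
  from Suc.prems have "Ck_on (Suc k) (\<lambda>x. frechet_derivative f (at x) v) S" for v
    by (subst (asm) Ck_on.simps(2)) blast
  then show ?case using Suc.prems Suc.IH by auto
qed

text \<open>Being \<open>C\<^sup>k\<close> is a local property. This lets a form be checked near each point in the chart
  that is convenient there.\<close>

lemma Ck_on_local:
  assumes "\<And>x. x \<in> S \<Longrightarrow> \<exists>T. open T \<and> x \<in> T \<and> Ck_on k f T"
  shows "Ck_on k f S"
  using assms
proof (induction k arbitrary: f)
  case 0
  then show ?case
    by (metis Ck_on.simps(1) continuous_at_imp_continuous_on continuous_on_eq_continuous_at)
next
  case (Suc k)
  have "f differentiable (at x)" if "x \<in> S" for x
    using Suc.prems[OF that] by auto
  moreover have "Ck_on k (\<lambda>x. frechet_derivative f (at x) v) S" for v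
    using Suc.prems by (intro Suc.IH) fastforce
  ultimately show ?case by simp
qed

lemma Ck_on_const: "Ck_on k (\<lambda>x. c) S"
  by (induction k arbitrary: c) auto

lemma Ck_on_add:
  assumes "open S" "Ck_on k f S" "Ck_on k g S"
  shows "Ck_on k (\<lambda>x. f x + g x) S"
  using assms(2,3)
proof (induction k arbitrary: f g)
  case 0
  then show ?case by (auto intro: continuous_on_add)
next
  case (Suc k)
  have "Ck_on k (\<lambda>x. frechet_derivative (\<lambda>x. f x + g x) (at x) v) S" for v
  proof (subst Ck_on_cong[OF \<open>open S\<close>])
    show "frechet_derivative (\<lambda>x. f x + g x) (at x) v =
      frechet_derivative f (at x) v + frechet_derivative g (at x) v" if "x \<in> S" for x
    proof -
      have "(f has_derivative frechet_derivative f (at x)) (at x)"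
        "(g has_derivative frechet_derivative g (at x)) (at x)"
        using Suc.prems that by (auto simp: frechet_derivative_works[symmetric])
      from frechet_derivative_at[OF has_derivative_add[OF this]] show ?thesis by metis
    qed
    show "Ck_on k (\<lambda>x. frechet_derivative f (at x) v + frechet_derivative g (at x) v) S"
      using Suc by simp
  qed
  then show ?case using Suc.prems by (auto intro: differentiable_add)
qed

lemma Ck_on_sum:
  assumes "open S" "\<And>i. i \<in> I \<Longrightarrow> Ck_on k (f i) S"
  shows "Ck_on k (\<lambda>x. \<Sum>i\<in>I. f i x) S"
  using assms(2)
  by (induction I rule: infinite_finite_induct) (auto intro: Ck_on_const Ck_on_add[OF \<open>open S\<close>])

lemma Ck_on_scaleR:
  assumes "open S" "Ck_on k f S" "Ck_on k g S"
  shows "Ck_on k (\<lambda>x. f x *\<^sub>R g x) S"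
  using assms(2,3)
proof (induction k arbitrary: f g)
  case 0
  then show ?case by (auto intro: continuous_on_scaleR)
next
  case (Suc k)
  have hd: "((\<lambda>x. f x *\<^sub>R g x) has_derivative
      (\<lambda>v. f x *\<^sub>R frechet_derivative g (at x) v + frechet_derivative f (at x) v *\<^sub>R g x)) (at x)"
    if "x \<in> S" for x
  proof -
    have "(f has_derivative frechet_derivative f (at x)) (at x)"
      "(g has_derivative frechet_derivative g (at x)) (at x)"
      using Suc.prems that by (auto simp: frechet_derivative_works[symmetric])
    then show ?thesis by (rule has_derivative_scaleR)
  qed
  have "Ck_on k (\<lambda>x. frechet_derivative (\<lambda>x. f x *\<^sub>R g x) (at x) v) S" for v
  proof (subst Ck_on_cong[OF \<open>open S\<close>])
    show "frechet_derivative (\<lambda>x. f x *\<^sub>R g x) (at x) v =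
      f x *\<^sub>R frechet_derivative g (at x) v + frechet_derivative f (at x) v *\<^sub>R g x" if "x \<in> S" for x
      using frechet_derivative_at[OF hd[OF that]] by metis
    have "Ck_on k f S" "Ck_on k g S"
      using Suc.prems by (auto intro: Ck_on_Suc_imp simp del: Ck_on.simps)
    then show "Ck_on k (\<lambda>x. f x *\<^sub>R frechet_derivative g (at x) v +
        frechet_derivative f (at x) v *\<^sub>R g x) S"
      using Suc by (auto intro!: Ck_on_add[OF \<open>open S\<close>])
  qed
  then show ?case using hd by (auto intro: differentiableI)
qed

lemma Ck_on_inner_const:
  assumes "open S" "Ck_on k f S"
  shows "Ck_on k (\<lambda>x. f x \<bullet> b) S"
  using assms(2)
proof (induction k arbitrary: f)
  case 0
  then show ?case by (auto intro: continuous_intros)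
next
  case (Suc k)
  have hd: "((\<lambda>x. f x \<bullet> b) has_derivative (\<lambda>v. frechet_derivative f (at x) v \<bullet> b)) (at x)"
    if "x \<in> S" for x
    using Suc.prems that
    by (intro has_derivative_inner_left) (auto simp: frechet_derivative_works[symmetric])
  have "Ck_on k (\<lambda>x. frechet_derivative (\<lambda>x. f x \<bullet> b) (at x) v) S" for v
  proof (subst Ck_on_cong[OF \<open>open S\<close>])
    show "frechet_derivative (\<lambda>x. f x \<bullet> b) (at x) v = frechet_derivative f (at x) v \<bullet> b"
      if "x \<in> S" for x
      using frechet_derivative_at[OF hd[OF that]] by metis
  qed (use Suc in auto)
  then show ?case using hd by (auto intro: differentiableI)
qed

lemma frechet_derivative_chain:
  assumes "f differentiable (at x)" "g differentiable (at (f x))"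
    and "open T" "x \<in> T" "\<And>y. y \<in> T \<Longrightarrow> h y = g (f y)"
  shows "h differentiable (at x)"
    and "frechet_derivative h (at x) w = frechet_derivative g (at (f x)) (frechet_derivative f (at x) w)"
proof -
  have "((g \<circ> f) has_derivative (frechet_derivative g (at (f x)) \<circ> frechet_derivative f (at x))) (at x)"
    using assms(1,2) by (intro diff_chain_at) (auto simp: frechet_derivative_works[symmetric])
  then have *: "(h has_derivative (frechet_derivative g (at (f x)) \<circ> frechet_derivative f (at x))) (at x)"
    by (rule has_derivative_transform_within_open[OF _ assms(3,4)]) (simp add: assms(5))
  then show "h differentiable (at x)" by (rule differentiableI)
  from frechet_derivative_at[OF *] show "frechet_derivative h (at x) w =
      frechet_derivative g (at (f x)) (frechet_derivative f (at x) w)"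
    by (metis comp_apply)
qed

lemma linear_eq_sum_Basis:
  fixes h :: "'e::euclidean_space \<Rightarrow> 'f::real_vector"
  assumes "linear h"
  shows "h u = (\<Sum>i\<in>Basis. (u \<bullet> i) *\<^sub>R h i)"
proof -
  have "h u = h (\<Sum>i\<in>Basis. (u \<bullet> i) *\<^sub>R i)" by (simp add: euclidean_representation)
  also have "\<dots> = (\<Sum>i\<in>Basis. (u \<bullet> i) *\<^sub>R h i)"
    by (simp add: linear_sum[OF assms] linear_scale[OF assms])
  finally show ?thesis .
qed

lemma Ck_on_compose:
  fixes f :: "'d::euclidean_space \<Rightarrow> 'e::euclidean_space" and g :: "'e \<Rightarrow> 'g::euclidean_space"
  assumes "open S" "Ck_on k f S" "Ck_on k g T" "f ` S \<subseteq> T"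
  shows "Ck_on k (\<lambda>x. g (f x)) S"
  using assms(2-4)
proof (induction k arbitrary: g)
  case 0
  then show ?case by (auto intro: continuous_on_compose2)
next
  case (Suc k)
  have df: "f differentiable (at x)" and dg: "g differentiable (at (f x))" if "x \<in> S" for x
    using Suc.prems that by auto
  note ch = frechet_derivative_chain[OF df dg \<open>open S\<close> _ refl]
  have fk: "Ck_on k f S" using Suc.prems(1) by (rule Ck_on_Suc_imp)
  have "Ck_on k (\<lambda>x. frechet_derivative (\<lambda>x. g (f x)) (at x) v) S" for v
  proof (subst Ck_on_cong[OF \<open>open S\<close>])
    show "frechet_derivative (\<lambda>x. g (f x)) (at x) v =
      (\<Sum>i\<in>Basis. (frechet_derivative f (at x) v \<bullet> i) *\<^sub>R frechet_derivative g (at (f x)) i)"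
      if "x \<in> S" for x
      using ch(2)[OF that that that, of v]
        linear_eq_sum_Basis[OF linear_frechet_derivative[OF dg[OF that]]] by metis
    have "Ck_on k (\<lambda>x. frechet_derivative g (at (f x)) i) S" for i
      using Suc.prems by (intro Suc.IH[OF fk]) auto
    then show "Ck_on k (\<lambda>x. \<Sum>i\<in>Basis. (frechet_derivative f (at x) v \<bullet> i) *\<^sub>R
        frechet_derivative g (at (f x)) i) S"
      using Suc.prems
      by (intro Ck_on_sum[OF \<open>open S\<close>] Ck_on_scaleR[OF \<open>open S\<close>] Ck_on_inner_const[OF \<open>open S\<close>]) auto
  qed
  then show ?case using ch(1) by auto
qed

lemma smooth_on_differentiable: "smooth_on S f \<Longrightarrow> x \<in> S \<Longrightarrow> f differentiable (at x)"
  unfolding smooth_on_def by (metis Ck_on.simps(2))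

lemma smooth_on_frechet_derivative:
  "smooth_on S f \<Longrightarrow> smooth_on S (\<lambda>x. frechet_derivative f (at x) v)"
  unfolding smooth_on_def by (metis Ck_on.simps(2))

section \<open>Symmetry of second derivatives\<close>

text \<open>The second difference of \<open>f\<close> over the parallelogram spanned by \<open>h v\<close> and \<open>h w\<close> is \<open>h\<^sup>2\<close> times the value
  of \<open>D\<^sub>v D\<^sub>w f\<close> at an interior point. As the second difference is symmetric in \<open>v\<close> and \<open>w\<close>, letting
  \<open>h\<close> tend to zero yields the symmetry of continuous second derivatives.\<close>

lemma second_difference_mean_value:
  fixes f :: "'e::euclidean_space \<Rightarrow> real"
  assumes "h > 0"
    and dom: "\<And>s t. 0 \<le> s \<Longrightarrow> s \<le> h \<Longrightarrow> 0 \<le> t \<Longrightarrow> t \<le> h \<Longrightarrow> x + s *\<^sub>R v + t *\<^sub>R w \<in> S"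
    and df: "\<And>y. y \<in> S \<Longrightarrow> f differentiable (at y)"
    and ddf: "\<And>y. y \<in> S \<Longrightarrow> (\<lambda>y. frechet_derivative f (at y) w) differentiable (at y)"
  obtains s t where "0 < s" "s < h" "0 < t" "t < h"
    "f (x + h *\<^sub>R v + h *\<^sub>R w) - f (x + h *\<^sub>R w) - (f (x + h *\<^sub>R v) - f x) =
      h * h * frechet_derivative (\<lambda>y. frechet_derivative f (at y) w) (at (x + s *\<^sub>R v + t *\<^sub>R w)) v"
proof -
  define f' where "f' = (\<lambda>y. frechet_derivative f (at y) w)"
  have line: "((\<lambda>t. F (a + t *\<^sub>R u)) has_real_derivative frechet_derivative F (at (a + t *\<^sub>R u)) u) (at t)"
    if "F differentiable (at (a + t *\<^sub>R u))" for F :: "'e \<Rightarrow> real" and a u t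
  proof -
    have "((\<lambda>t. a + t *\<^sub>R u) has_derivative (\<lambda>t. t *\<^sub>R u)) (at t)"
      by (auto intro!: derivative_eq_intros)
    moreover have F: "(F has_derivative frechet_derivative F (at (a + t *\<^sub>R u))) (at (a + t *\<^sub>R u))"
      using that by (simp add: frechet_derivative_works[symmetric])
    ultimately have "(F \<circ> (\<lambda>t. a + t *\<^sub>R u) has_derivative
        frechet_derivative F (at (a + t *\<^sub>R u)) \<circ> (\<lambda>t. t *\<^sub>R u)) (at t)"
      by (rule diff_chain_at)
    moreover have "frechet_derivative F (at (a + t *\<^sub>R u)) (r *\<^sub>R u) =
        frechet_derivative F (at (a + t *\<^sub>R u)) u * r" for r
      using linear_scale[OF has_derivative_linear[OF F]] by (simp add: mult.commute)
    ultimately show ?thesis by (simp add: has_field_derivative_def o_def)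
  qed
  \<comment> \<open>Two applications of the mean value theorem: one to the difference of \<open>f\<close> along two parallel
    segments in direction \<open>w\<close>, one to the derivative \<open>f'\<close> along a segment in direction \<open>v\<close>.\<close>
  define \<phi> where "\<phi> = (\<lambda>t. f (x + h *\<^sub>R v + t *\<^sub>R w) - f (x + t *\<^sub>R w))"
  have "(\<phi> has_real_derivative f' (x + h *\<^sub>R v + t *\<^sub>R w) - f' (x + t *\<^sub>R w)) (at t)"
    if "0 \<le> t" "t \<le> h" for t
    unfolding \<phi>_def f'_def
    using dom[of h t] dom[of 0 t] that \<open>h > 0\<close>
    by (intro DERIV_diff line df) auto
  from MVT2[OF \<open>h > 0\<close>, of \<phi>, OF this]
  obtain t where t: "0 < t" "t < h"
    and 1: "\<phi> h - \<phi> 0 = h * (f' (x + h *\<^sub>R v + t *\<^sub>R w) - f' (x + t *\<^sub>R w))" by auto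
  have "((\<lambda>s. f' ((x + t *\<^sub>R w) + s *\<^sub>R v)) has_real_derivative
      frechet_derivative f' (at ((x + t *\<^sub>R w) + s *\<^sub>R v)) v) (at s)" if "0 \<le> s" "s \<le> h" for s
    using ddf[OF dom[of s t]] that t by (intro line) (simp add: f'_def algebra_simps)
  from MVT2[OF \<open>h > 0\<close>, of "\<lambda>s. f' ((x + t *\<^sub>R w) + s *\<^sub>R v)", OF this]
  obtain s where s: "0 < s" "s < h"
    and 2: "f' ((x + t *\<^sub>R w) + h *\<^sub>R v) - f' (x + t *\<^sub>R w) =
      h * frechet_derivative f' (at ((x + t *\<^sub>R w) + s *\<^sub>R v)) v" by auto
  have "\<phi> h - \<phi> 0 = h * h * frechet_derivative f' (at (x + s *\<^sub>R v + t *\<^sub>R w)) v"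
    using 1 2 by (simp add: algebra_simps)
  then show ?thesis
    using that[OF s t] by (simp add: \<phi>_def f'_def)
qed

lemma mixed_derivatives_commute_real:
  fixes f :: "'e::euclidean_space \<Rightarrow> real"
  assumes "open S" "x \<in> S" and C2: "Ck_on 2 f S"
  shows "frechet_derivative (\<lambda>y. frechet_derivative f (at y) w) (at x) v =
         frechet_derivative (\<lambda>y. frechet_derivative f (at y) v) (at x) w"
proof -
  define D where "D = (\<lambda>v w x. frechet_derivative (\<lambda>y. frechet_derivative f (at y) w) (at x) v)"
  have C2': "Ck_on (Suc (Suc 0)) f S" using C2 by (simp add: numeral_2_eq_2)
  have df: "f differentiable (at y)" if "y \<in> S" for y using C2' that by simp
  have ddf: "(\<lambda>y. frechet_derivative f (at y) w) differentiable (at y)" if "y \<in> S" for y w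
    using C2' that by simp
  have cont: "isCont (D v w) x" for v w
    using C2' assms(1,2) unfolding D_def by (simp add: continuous_on_eq_continuous_at)
  have close: "\<bar>D v w x - D w v x\<bar> \<le> e + e" if e: "e > 0" for e
  proof -
    obtain d1 where d1: "d1 > 0" "\<And>y. dist y x < d1 \<Longrightarrow> dist (D v w y) (D v w x) < e"
      using cont[of v w, unfolded continuous_at_eps_delta, rule_format, OF e] by metis
    obtain d2 where d2: "d2 > 0" "\<And>y. dist y x < d2 \<Longrightarrow> dist (D w v y) (D w v x) < e"
      using cont[of w v, unfolded continuous_at_eps_delta, rule_format, OF e] by metis
    obtain r where r: "r > 0" "ball x r \<subseteq> S"
      using assms(1,2) open_contains_ball by blast
    define m where "m = Min {d1, d2, r}"
    have m: "m > 0" "m \<le> d1" "m \<le> d2" "m \<le> r" using d1 d2 r by (auto simp: m_def)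
    \<comment> \<open>So small that the parallelogram at \<open>x\<close> with sides \<open>h v\<close> and \<open>h w\<close> lies in the \<open>m\<close>-ball.\<close>
    define h where "h = m / (2 * (norm v + norm w + 1))"
    have nn: "norm v + norm w + 1 > 0" by (smt (verit) norm_ge_zero)
    have h: "h > 0" using m nn by (simp add: h_def)
    have near: "dist (x + s *\<^sub>R v + t *\<^sub>R w) x < m"
      if "0 \<le> s" "s \<le> h" "0 \<le> t" "t \<le> h" for s t
    proof -
      have "dist (x + s *\<^sub>R v + t *\<^sub>R w) x \<le> norm (s *\<^sub>R v) + norm (t *\<^sub>R w)"
        using norm_triangle_ineq[of "s *\<^sub>R v" "t *\<^sub>R w"] by (simp add: dist_norm add.assoc)
      also have "\<dots> \<le> h * norm v + h * norm w"
        using that by (auto intro!: add_mono mult_right_mono)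
      also have "\<dots> < h * (2 * (norm v + norm w + 1))"
      proof -
        have "norm v + norm w < 2 * (norm v + norm w + 1)"
          by (smt (verit) norm_ge_zero)
        then have "h * (norm v + norm w) < h * (2 * (norm v + norm w + 1))"
          using h by (rule mult_strict_left_mono)
        then show ?thesis by (simp add: distrib_left)
      qed
      also have "\<dots> = m" using nn by (simp add: h_def)
      finally show ?thesis .
    qed
    have dom: "x + s *\<^sub>R v + t *\<^sub>R w \<in> S" if "0 \<le> s" "s \<le> h" "0 \<le> t" "t \<le> h" for s t
      using near[OF that] m r by (auto simp: subset_eq dist_commute)
    have dom': "x + s *\<^sub>R w + t *\<^sub>R v \<in> S" if "0 \<le> s" "s \<le> h" "0 \<le> t" "t \<le> h" for s t
      using dom[OF that(3,4,1,2)] by (simp add: add_ac)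
    obtain s t where st: "0 < s" "s < h" "0 < t" "t < h" and
      1: "f (x + h *\<^sub>R v + h *\<^sub>R w) - f (x + h *\<^sub>R w) - (f (x + h *\<^sub>R v) - f x) =
        h * h * D v w (x + s *\<^sub>R v + t *\<^sub>R w)"
      unfolding D_def by (rule second_difference_mean_value[OF h dom df ddf])
    obtain s' t' where st': "0 < s'" "s' < h" "0 < t'" "t' < h" and
      2: "f (x + h *\<^sub>R w + h *\<^sub>R v) - f (x + h *\<^sub>R v) - (f (x + h *\<^sub>R w) - f x) =
        h * h * D w v (x + s' *\<^sub>R w + t' *\<^sub>R v)"
      unfolding D_def by (rule second_difference_mean_value[OF h dom' df ddf])
    have "h * h * D v w (x + s *\<^sub>R v + t *\<^sub>R w) = h * h * D w v (x + s' *\<^sub>R w + t' *\<^sub>R v)"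
    proof -
      have "f (x + h *\<^sub>R w + h *\<^sub>R v) = f (x + h *\<^sub>R v + h *\<^sub>R w)" by (simp add: add_ac)
      with 1 2 show ?thesis by linarith
    qed
    then have eq: "D v w (x + s *\<^sub>R v + t *\<^sub>R w) = D w v (x + t' *\<^sub>R v + s' *\<^sub>R w)"
      using h by (simp add: add_ac)
    have "dist (D v w (x + s *\<^sub>R v + t *\<^sub>R w)) (D v w x) < e"
      using near[of s t] st m by (intro d1(2)) auto
    moreover have "dist (D w v (x + t' *\<^sub>R v + s' *\<^sub>R w)) (D w v x) < e"
      using near[of t' s'] st' m by (intro d2(2)) auto
    ultimately show ?thesis using eq by (simp add: dist_real_def)
  qed
  have "D v w x = D w v x"
  proof (rule ccontr)
    assume "D v w x \<noteq> D w v x"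
    then show False using close[of "\<bar>D v w x - D w v x\<bar> / 3"] by (simp add: field_simps)
  qed
  then show ?thesis by (simp add: D_def)
qed

lemma mixed_derivatives_commute:
  fixes f :: "'e::euclidean_space \<Rightarrow> 'f::euclidean_space"
  assumes "open S" "x \<in> S" and C2: "Ck_on 2 f S"
  shows "frechet_derivative (\<lambda>y. frechet_derivative f (at y) w) (at x) v =
         frechet_derivative (\<lambda>y. frechet_derivative f (at y) v) (at x) w"
proof (rule euclidean_eqI)
  fix b :: 'f
  have C2': "Ck_on (Suc (Suc 0)) f S" using C2 by (simp add: numeral_2_eq_2)
  have inner: "frechet_derivative (\<lambda>y. F y \<bullet> b) (at y) u = frechet_derivative F (at y) u \<bullet> b"
    if "F differentiable (at y)" for F :: "'e \<Rightarrow> 'f" and y u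
  proof -
    have "((\<lambda>y. F y \<bullet> b) has_derivative (\<lambda>u. frechet_derivative F (at y) u \<bullet> b)) (at y)"
      using that by (intro has_derivative_inner_left) (simp add: frechet_derivative_works[symmetric])
    from frechet_derivative_at[OF this] show ?thesis by metis
  qed
  have *: "frechet_derivative (\<lambda>y. frechet_derivative (\<lambda>y. f y \<bullet> b) (at y) w) (at x) v =
      frechet_derivative (\<lambda>y. frechet_derivative f (at y) w) (at x) v \<bullet> b" for v w
  proof -
    have "frechet_derivative (\<lambda>y. frechet_derivative f (at y) w \<bullet> b) (at x) =
        frechet_derivative (\<lambda>y. frechet_derivative (\<lambda>y. f y \<bullet> b) (at y) w) (at x)"
      using C2' assms(1,2) by (intro frechet_derivative_transform_within_open[of _ _ S])
        (auto simp: inner intro!: differentiable_inner)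
    moreover have "frechet_derivative (\<lambda>y. frechet_derivative f (at y) w \<bullet> b) (at x) v =
      frechet_derivative (\<lambda>y. frechet_derivative f (at y) w) (at x) v \<bullet> b"
      using C2' assms(2) by (intro inner) auto
    ultimately show ?thesis by metis
  qed
  show "frechet_derivative (\<lambda>y. frechet_derivative f (at y) w) (at x) v \<bullet> b =
      frechet_derivative (\<lambda>y. frechet_derivative f (at y) v) (at x) w \<bullet> b"
    using mixed_derivatives_commute_real[OF assms(1,2) Ck_on_inner_const[OF assms(1) C2], of b w v]
    by (simp add: *)
qed

section \<open>Charts, tangent vectors and differentials\<close>

lemma smooth_manifold_is_chart: "smooth_manifold X A \<Longrightarrow> c \<in> A \<Longrightarrow> is_chart X c"
  by (simp add: smooth_manifold_def)

lemma chart_domain_subset: "smooth_manifold X A \<Longrightarrow> c \<in> A \<Longrightarrow> fst c \<subseteq> topspace X"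
  by (meson is_chart_def openin_subset smooth_manifold_is_chart)

lemma chart_inv_chart:
  assumes "smooth_manifold X A" "c \<in> A" "p \<in> fst c"
  shows "chart_inv c (snd c p) = p"
proof -
  have "homeomorphic_map (subtopology X (fst c)) (top_of_set (snd c ` fst c)) (snd c)"
    using smooth_manifold_is_chart[OF assms(1,2)] by (simp add: is_chart_def)
  then have "inj_on (snd c) (fst c)"
    using homeomorphic_imp_injective_map chart_domain_subset[OF assms(1,2)]
    by (metis inf.absorb2 topspace_subtopology)
  then show ?thesis using assms(3) by (simp add: chart_inv_def)
qed

lemma open_chart_image:
  assumes "smooth_manifold X A" "c \<in> A" "openin X U"
  shows "open (snd c ` (fst c \<inter> U))"
proof -
  have ch: "open (snd c ` fst c)"
    "homeomorphic_map (subtopology X (fst c)) (top_of_set (snd c ` fst c)) (snd c)"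
    using smooth_manifold_is_chart[OF assms(1,2)] by (simp_all add: is_chart_def)
  have "openin (subtopology X (fst c)) (fst c \<inter> U)"
    using assms(3) by (simp add: openin_subtopology_Int2)
  then have "openin (top_of_set (snd c ` fst c)) (snd c ` (fst c \<inter> U))"
    using homeomorphic_imp_open_map[OF ch(2)] by (simp add: open_map_def)
  then show ?thesis using ch(1) openin_open_eq by blast
qed

lemma chart_at_chart:
  assumes "smooth_manifold X A" "p \<in> topspace X"
  shows "chart_at A p \<in> A" "p \<in> fst (chart_at A p)"
proof -
  have "\<exists>c. c \<in> A \<and> p \<in> fst c"
    using assms unfolding smooth_manifold_def by blast
  from someI_ex[OF this] show "chart_at A p \<in> A" "p \<in> fst (chart_at A p)"
    by (simp_all add: chart_at_def)
qed

lemma smooth_map_ident: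
  assumes "smooth_manifold X A"
  shows "smooth_map X A X A (\<lambda>p. p)"
proof -
  have "smooth_on (snd c ` {p \<in> fst c. p \<in> fst d}) (snd d \<circ> (\<lambda>p. p) \<circ> chart_inv c)"
    if "c \<in> A" "d \<in> A" for c d
  proof -
    have "{p \<in> fst c. p \<in> fst d} = fst c \<inter> fst d" by auto
    then show ?thesis using assms that by (simp add: smooth_manifold_def o_def)
  qed
  then show ?thesis by (simp add: smooth_map_def)
qed

lemma open_smooth_map_domain:
  assumes "smooth_manifold X A" "smooth_manifold Y B" "smooth_map X A Y B F" "c \<in> A" "d \<in> B"
  shows "open (snd c ` {p \<in> fst c. F p \<in> fst d})"
proof -
  have "openin X {p \<in> topspace X. F p \<in> fst d}"
    using assms smooth_manifold_is_chart[OF assms(2,5)]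
    by (intro openin_continuous_map_preimage[of X Y F]) (auto simp: smooth_map_def is_chart_def)
  from open_chart_image[OF assms(1,4) this]
  have "open (snd c ` (fst c \<inter> {p \<in> topspace X. F p \<in> fst d}))" .
  moreover have "fst c \<inter> {p \<in> topspace X. F p \<in> fst d} = {p \<in> fst c. F p \<in> fst d}"
    using chart_domain_subset[OF assms(1,4)] by auto
  ultimately show ?thesis by simp
qed

lemma smooth_map_local_smooth:
  "smooth_map X A Y B F \<Longrightarrow> c \<in> A \<Longrightarrow> d \<in> B \<Longrightarrow>
    smooth_on (snd c ` {p \<in> fst c. F p \<in> fst d}) (snd d \<circ> F \<circ> chart_inv c)"
  by (simp add: smooth_map_def)

lemma smooth_map_local_differentiable:
  "smooth_map X A Y B F \<Longrightarrow> c \<in> A \<Longrightarrow> d \<in> B \<Longrightarrow> p \<in> fst c \<Longrightarrow> F p \<in> fst d \<Longrightarrow>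
    (snd d \<circ> F \<circ> chart_inv c) differentiable (at (snd c p))"
  using smooth_on_differentiable[OF smooth_map_local_smooth] by blast

text \<open>The chain rule in charts. Applied with one or both maps equal to the identity, it gives the
  cocycle property of the derivatives of transition maps, and the independence of differentials of
  the charts used to compute them.\<close>

lemma local_chain_rule:
  assumes X: "smooth_manifold X A" and Y: "smooth_manifold Y B"
    and F: "smooth_map X A Y B F" and G: "smooth_map Y B Z C G"
    and c: "c \<in> A" "p \<in> fst c" and d: "d \<in> B" "F p \<in> fst d" and e: "e \<in> C" "G (F p) \<in> fst e"
  shows "frechet_derivative (snd e \<circ> (\<lambda>q. G (F q)) \<circ> chart_inv c) (at (snd c p)) w =
    frechet_derivative (snd e \<circ> G \<circ> chart_inv d) (at (snd d (F p)))
      (frechet_derivative (snd d \<circ> F \<circ> chart_inv c) (at (snd c p)) w)"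
proof -
  let ?f = "snd d \<circ> F \<circ> chart_inv c" and ?g = "snd e \<circ> G \<circ> chart_inv d"
  have fp: "?f (snd c p) = snd d (F p)"
    by (simp add: chart_inv_chart[OF X c])
  have f: "?f differentiable (at (snd c p))"
    by (rule smooth_map_local_differentiable[OF F c(1) d(1) c(2) d(2)])
  have g: "?g differentiable (at (?f (snd c p)))"
    unfolding fp by (rule smooth_map_local_differentiable[OF G d(1) e(1) d(2) e(2)])
  have "(snd e \<circ> (\<lambda>q. G (F q)) \<circ> chart_inv c) y = ?g (?f y)"
    if "y \<in> snd c ` {p \<in> fst c. F p \<in> fst d}" for y
    using that by (auto simp: chart_inv_chart[OF X c(1)] chart_inv_chart[OF Y d(1)])
  from frechet_derivative_chain(2)[OF f g open_smooth_map_domain[OF X Y F c(1) d(1)] _ this]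
  show ?thesis using c d unfolding fp by blast
qed

lemma transition_differentiable:
  assumes "smooth_manifold X A" "c \<in> A" "d \<in> A" "p \<in> fst c" "p \<in> fst d"
  shows "(snd d \<circ> chart_inv c) differentiable (at (snd c p))"
  using smooth_map_local_differentiable[OF smooth_map_ident[OF assms(1)] assms(2-5)]
  by (simp add: o_def)

lemma transition_cocycle:
  assumes X: "smooth_manifold X A" and "c \<in> A" "p \<in> fst c" "d \<in> A" "p \<in> fst d" "e \<in> A" "p \<in> fst e"
  shows "frechet_derivative (snd e \<circ> chart_inv c) (at (snd c p)) w =
    frechet_derivative (snd e \<circ> chart_inv d) (at (snd d p))
      (frechet_derivative (snd d \<circ> chart_inv c) (at (snd c p)) w)"
  using local_chain_rule[OF X X smooth_map_ident[OF X] smooth_map_ident[OF X], of c p d e w] assms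
  by (simp add: o_def)

lemma transition_self:
  assumes X: "smooth_manifold X A" and c: "c \<in> A" "p \<in> fst c"
  shows "frechet_derivative (snd c \<circ> chart_inv c) (at (snd c p)) w = w"
proof -
  have "open (snd c ` fst c)"
    using smooth_manifold_is_chart[OF X c(1)] by (simp add: is_chart_def)
  then have "((snd c \<circ> chart_inv c) has_derivative (\<lambda>w. w)) (at (snd c p))"
    using c(2) by (intro has_derivative_transform_within_open[OF has_derivative_ident, of "snd c ` fst c"])
      (auto simp: chart_inv_chart[OF X c(1)])
  from frechet_derivative_at[OF this] show ?thesis by metis
qed

lemma coord_vec_self:
  assumes "smooth_manifold X A" "c \<in> A" "p \<in> fst c"
  shows "coord_vec A c p w c = w"
  using assms by (simp add: coord_vec_def transition_self)

lemma coord_vec_in_tangent_space: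
  assumes "smooth_manifold X A" "c \<in> A" "p \<in> fst c"
  shows "coord_vec A c p w \<in> tangent_space A p"
proof -
  have "coord_vec A c p w e = frechet_derivative (snd e \<circ> chart_inv d) (at (snd d p)) (coord_vec A c p w d)"
    if "d \<in> A" "e \<in> A" "p \<in> fst d" "p \<in> fst e" for d e
    using transition_cocycle[OF assms that(1,3,2,4), of w] that by (simp add: coord_vec_def)
  moreover have "coord_vec A c p w d = 0" if "\<not> (d \<in> A \<and> p \<in> fst d)" for d
    using that by (auto simp: coord_vec_def)
  ultimately show ?thesis unfolding tangent_space_def by blast
qed

lemma coord_vec_tangent:
  assumes "v \<in> tangent_space A p" "c \<in> A" "p \<in> fst c"
  shows "coord_vec A c p (v c) = v"
proof
  fix d
  show "coord_vec A c p (v c) d = v d"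
  proof (cases "d \<in> A \<and> p \<in> fst d")
    case True
    then have "v d = frechet_derivative (snd d \<circ> chart_inv c) (at (snd c p)) (v c)"
      using assms unfolding tangent_space_def by blast
    with True show ?thesis by (simp add: coord_vec_def)
  next
    case False
    then have "v d = 0" using assms unfolding tangent_space_def by blast
    with False show ?thesis by (auto simp: coord_vec_def)
  qed
qed

lemma coord_vec_lincomb:
  assumes "smooth_manifold X A" "c \<in> A" "p \<in> fst c"
  shows "coord_vec A c p (a *\<^sub>R u + b *\<^sub>R w) = tlincomb a (coord_vec A c p u) b (coord_vec A c p w)"
proof
  fix d
  show "coord_vec A c p (a *\<^sub>R u + b *\<^sub>R w) d = tlincomb a (coord_vec A c p u) b (coord_vec A c p w) d"
  proof (cases "d \<in> A \<and> p \<in> fst d")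
    case True
    then have "linear (frechet_derivative (snd d \<circ> chart_inv c) (at (snd c p)))"
      using transition_differentiable[OF assms(1,2) _ assms(3)] by (intro linear_frechet_derivative) auto
    with True show ?thesis
      by (simp add: coord_vec_def tlincomb_def linear_add linear_scale)
  next
    case False
    then show ?thesis by (auto simp: coord_vec_def tlincomb_def)
  qed
qed

lemma coord_vec_zero:
  assumes "smooth_manifold X A" "c \<in> A" "p \<in> fst c"
  shows "coord_vec A c p 0 = tzero"
  using coord_vec_lincomb[OF assms, of 0 0 0 0] by (simp add: tlincomb_def tzero_def)

lemma tlincomb_in_tangent_space:
  assumes "smooth_manifold X A" "p \<in> topspace X" "v \<in> tangent_space A p" "w \<in> tangent_space A p"
  shows "tlincomb a v b w \<in> tangent_space A p"
proof -
  note c = chart_at_chart[OF assms(1,2)]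
  have "tlincomb a v b w =
      coord_vec A (chart_at A p) p (a *\<^sub>R v (chart_at A p) + b *\<^sub>R w (chart_at A p))"
    using coord_vec_tangent[OF assms(3) c] coord_vec_tangent[OF assms(4) c]
    by (simp add: coord_vec_lincomb[OF assms(1) c])
  then show ?thesis using coord_vec_in_tangent_space[OF assms(1) c] by simp
qed

text \<open>A covector, read in the coordinates of a chart, is a linear functional on the model space.\<close>

lemma linear_coord_comp:
  assumes X: "smooth_manifold X A" and c: "c \<in> A" "p \<in> fst c" and h: "linear_on_tangent A p h"
  shows "linear (\<lambda>w. h (coord_vec A c p w))"
proof (rule linearI)
  have *: "h (coord_vec A c p (a *\<^sub>R u + b *\<^sub>R w)) =
      a * h (coord_vec A c p u) + b * h (coord_vec A c p w)" for a b u w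
    using h coord_vec_in_tangent_space[OF X c]
    by (simp add: coord_vec_lincomb[OF X c] linear_on_tangent_def)
  show "h (coord_vec A c p (u + w)) = h (coord_vec A c p u) + h (coord_vec A c p w)" for u w
    using *[of 1 u 1 w] by simp
  show "h (coord_vec A c p (r *\<^sub>R u)) = r *\<^sub>R h (coord_vec A c p u)" for r u
    using *[of r u 0 0] by simp
qed

text \<open>The differential is defined through an arbitrary choice of a chart of the source; it may be
  computed in any chart.\<close>

lemma map_differential_chart:
  assumes X: "smooth_manifold X A" and F: "smooth_map X A Y B F"
    and v: "v \<in> tangent_space A p" and c: "c \<in> A" "p \<in> fst c" and d: "d \<in> B" "F p \<in> fst d"
  shows "map_differential A B F p v d =
    frechet_derivative (snd d \<circ> F \<circ> chart_inv c) (at (snd c p)) (v c)"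
proof -
  have "p \<in> topspace X" using chart_domain_subset[OF X c(1)] c(2) by auto
  note c' = chart_at_chart[OF X this]
  have "v (chart_at A p) = frechet_derivative (snd (chart_at A p) \<circ> chart_inv c) (at (snd c p)) (v c)"
    using v c c' unfolding tangent_space_def by blast
  then show ?thesis
    using local_chain_rule[OF X X smooth_map_ident[OF X] F c c' d] d
    by (simp add: map_differential_def Let_def o_def)
qed

lemma map_differential_eq_coord_vec:
  assumes X: "smooth_manifold X A" and Y: "smooth_manifold Y B" and F: "smooth_map X A Y B F"
    and v: "v \<in> tangent_space A p" and c: "c \<in> A" "p \<in> fst c" and d: "d \<in> B" "F p \<in> fst d"
  shows "map_differential A B F p v =
    coord_vec B d (F p) (frechet_derivative (snd d \<circ> F \<circ> chart_inv c) (at (snd c p)) (v c))"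
proof
  fix e
  show "map_differential A B F p v e =
    coord_vec B d (F p) (frechet_derivative (snd d \<circ> F \<circ> chart_inv c) (at (snd c p)) (v c)) e"
  proof (cases "e \<in> B \<and> F p \<in> fst e")
    case True
    then show ?thesis
      using local_chain_rule[OF X Y F smooth_map_ident[OF Y] c d, of e "v c"]
      by (simp add: map_differential_chart[OF X F v c] coord_vec_def o_def)
  next
    case False
    then show ?thesis by (auto simp: map_differential_def Let_def coord_vec_def)
  qed
qed

lemma map_differential_in_tangent_space:
  assumes X: "smooth_manifold X A" and Y: "smooth_manifold Y B" and F: "smooth_map X A Y B F"
    and p: "p \<in> topspace X" and v: "v \<in> tangent_space A p"
  shows "map_differential A B F p v \<in> tangent_space B (F p)"
proof -
  have "F p \<in> topspace Y" using F p by (auto simp: smooth_map_def continuous_map_def)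
  note c = chart_at_chart[OF X p] and d = chart_at_chart[OF Y this]
  show ?thesis
    unfolding map_differential_eq_coord_vec[OF X Y F v c d] by (rule coord_vec_in_tangent_space[OF Y d])
qed

lemma map_differential_lincomb:
  assumes X: "smooth_manifold X A" and Y: "smooth_manifold Y B" and F: "smooth_map X A Y B F"
    and p: "p \<in> topspace X" and v: "v \<in> tangent_space A p" and w: "w \<in> tangent_space A p"
  shows "map_differential A B F p (tlincomb a v b w) =
    tlincomb a (map_differential A B F p v) b (map_differential A B F p w)"
proof -
  have "F p \<in> topspace Y" using F p by (auto simp: smooth_map_def continuous_map_def)
  note c = chart_at_chart[OF X p] and d = chart_at_chart[OF Y this]
  define D where "D = frechet_derivative (snd (chart_at B (F p)) \<circ> F \<circ> chart_inv (chart_at A p))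
    (at (snd (chart_at A p) p))"
  have "linear D"
    unfolding D_def by (intro linear_frechet_derivative smooth_map_local_differentiable[OF F] c d)
  then have "D (tlincomb a v b w (chart_at A p)) = a *\<^sub>R D (v (chart_at A p)) + b *\<^sub>R D (w (chart_at A p))"
    by (simp add: tlincomb_def linear_add linear_scale)
  then show ?thesis
    unfolding map_differential_eq_coord_vec[OF X Y F v c d] map_differential_eq_coord_vec[OF X Y F w c d]
      map_differential_eq_coord_vec[OF X Y F tlincomb_in_tangent_space[OF X p v w] c d] D_def[symmetric]
    by (simp add: coord_vec_lincomb[OF Y d])
qed

section \<open>Pullback of closed one-forms\<close>

text \<open>The pullback of a one-form along a map \<open>F\<close>. Following the convention for one-forms, it is extended
  by zero to everything that is not a tangent vector at a point of the manifold.\<close>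

definition pullback_form ::
    "'a topology \<Rightarrow> ('a, 'e::euclidean_space) chart set \<Rightarrow> ('b, 'f::euclidean_space) chart set \<Rightarrow>
     ('a \<Rightarrow> 'b) \<Rightarrow> ('b, 'f) form1 \<Rightarrow> ('a, 'e) form1" where
  "pullback_form X A B F \<omega> = (\<lambda>p v.
     if p \<in> topspace X \<and> v \<in> tangent_space A p then \<omega> (F p) (map_differential A B F p v) else 0)"

text \<open>With \<open>\<phi>\<close> the coordinate expression of \<open>F\<close> and \<open>a\<close> that of the form, the pullback has the
  coordinate expression \<open>a (\<phi> x) (D\<phi>(x) w)\<close>.\<close>

lemma form_comp_pullback:
  assumes X: "smooth_manifold X A" and Y: "smooth_manifold Y B" and F: "smooth_map X A Y B F"
    and c: "c \<in> A" and d: "d \<in> B" and x: "x \<in> snd c ` {p \<in> fst c. F p \<in> fst d}"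
  shows "form_comp A (pullback_form X A B F \<omega>) c x w =
    form_comp B \<omega> d ((snd d \<circ> F \<circ> chart_inv c) x)
      (frechet_derivative (snd d \<circ> F \<circ> chart_inv c) (at x) w)"
proof -
  obtain p where p: "p \<in> fst c" "F p \<in> fst d" "x = snd c p" using x by auto
  have pX: "p \<in> topspace X" using chart_domain_subset[OF X c] p by auto
  note t = coord_vec_in_tangent_space[OF X c p(1)]
  show ?thesis
    using pX t
    by (simp add: form_comp_def pullback_form_def p(3) chart_inv_chart[OF X c p(1)]
        chart_inv_chart[OF Y d p(2)] map_differential_eq_coord_vec[OF X Y F t c p(1) d p(2)]
        coord_vec_self[OF X c p(1)])
qed

lemma form_comp_linear:
  assumes X: "smooth_manifold X A" and \<omega>: "\<omega> \<in> one_forms_on A W" and c: "c \<in> A"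
    and x: "x \<in> snd c ` (fst c \<inter> W)"
  shows "linear (form_comp A \<omega> c x)"
proof -
  obtain p where p: "p \<in> fst c" "p \<in> W" "x = snd c p" using x by auto
  have "linear (\<lambda>w. \<omega> p (coord_vec A c p w))"
    using \<omega> p(2) by (intro linear_coord_comp[OF X c p(1)]) (simp add: one_forms_on_def)
  then show ?thesis
    by (simp add: form_comp_def[abs_def] p(3) chart_inv_chart[OF X c p(1)])
qed

lemma pullback_in_one_forms:
  fixes A :: "('a, 'e::euclidean_space) chart set" and B :: "('b, 'f::euclidean_space) chart set"
  assumes X: "smooth_manifold X A" and Y: "smooth_manifold Y B" and F: "smooth_map X A Y B F"
    and W: "openin Y W" "F ` topspace X \<subseteq> W" and \<omega>: "\<omega> \<in> one_forms_on B W"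
  shows "pullback_form X A B F \<omega> \<in> one_forms_on A (topspace X)"
proof -
  let ?P = "pullback_form X A B F \<omega>"
  have lin: "linear_on_tangent A p (?P p)" if p: "p \<in> topspace X" for p
  proof -
    have Fp: "F p \<in> W" "F p \<in> topspace Y" using W p openin_subset by blast+
    then have "linear_on_tangent B (F p) (\<omega> (F p))" using \<omega> by (simp add: one_forms_on_def)
    then show ?thesis
      using p by (simp add: linear_on_tangent_def pullback_form_def tlincomb_in_tangent_space[OF X p]
          map_differential_in_tangent_space[OF X Y F p] map_differential_lincomb[OF X Y F p])
  qed
  have smooth: "Ck_on k (\<lambda>x. form_comp A ?P c x w) (snd c ` (fst c \<inter> topspace X))"
    if c: "c \<in> A" for c w k
  proof (rule Ck_on_local)
    fix x assume "x \<in> snd c ` (fst c \<inter> topspace X)"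
    then obtain p where p: "p \<in> fst c" "p \<in> topspace X" "x = snd c p" by auto
    then have FpY: "F p \<in> topspace Y" using W openin_subset by blast
    define d where "d = chart_at B (F p)"
    note d = chart_at_chart[OF Y FpY, folded d_def]
    define T where "T = snd c ` {p \<in> fst c. F p \<in> fst d}"
    define \<phi> where "\<phi> = snd d \<circ> F \<circ> chart_inv c"
    have T: "open T" unfolding T_def by (rule open_smooth_map_domain[OF X Y F c d(1)])
    have \<phi>: "smooth_on T \<phi>"
      unfolding T_def \<phi>_def by (rule smooth_map_local_smooth[OF F c d(1)])
    have "F q \<in> W" if "q \<in> fst c" for q
      using W(2) chart_domain_subset[OF X c] that by blast
    then have \<phi>T: "\<phi> ` T \<subseteq> snd d ` (fst d \<inter> W)"
      by (auto simp: T_def \<phi>_def chart_inv_chart[OF X c])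
    have eq: "form_comp A ?P c y w =
        (\<Sum>i\<in>Basis. (frechet_derivative \<phi> (at y) w \<bullet> i) *\<^sub>R form_comp B \<omega> d (\<phi> y) i)" if "y \<in> T" for y
    proof -
      have "form_comp A ?P c y w = form_comp B \<omega> d (\<phi> y) (frechet_derivative \<phi> (at y) w)"
        unfolding \<phi>_def by (rule form_comp_pullback[OF X Y F c d(1)]) (use that T_def in simp)
      also have "\<dots> = (\<Sum>i\<in>Basis. (frechet_derivative \<phi> (at y) w \<bullet> i) *\<^sub>R form_comp B \<omega> d (\<phi> y) i)"
        using \<phi>T that by (intro linear_eq_sum_Basis form_comp_linear[OF Y \<omega> d(1)]) auto
      finally show ?thesis .
    qed
    have \<phi>k: "Ck_on k \<phi> T" "Ck_on k (\<lambda>y. frechet_derivative \<phi> (at y) w) T"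
      using \<phi> smooth_on_frechet_derivative[OF \<phi>] by (simp_all add: smooth_on_def)
    have "Ck_on k (\<lambda>y. form_comp B \<omega> d y i) (snd d ` (fst d \<inter> W))" for i
      using \<omega> d(1) by (simp add: one_forms_on_def smooth_on_def)
    from Ck_on_compose[OF T \<phi>k(1) this \<phi>T]
    have "Ck_on k (\<lambda>y. \<Sum>i\<in>Basis. (frechet_derivative \<phi> (at y) w \<bullet> i) *\<^sub>R
        form_comp B \<omega> d (\<phi> y) i) T"
      using \<phi>k(2) by (intro Ck_on_sum[OF T] Ck_on_scaleR[OF T] Ck_on_inner_const[OF T])
    moreover have "Ck_on k (\<lambda>x. form_comp A ?P c x w) T \<longleftrightarrow> Ck_on k (\<lambda>y. \<Sum>i\<in>Basis.
        (frechet_derivative \<phi> (at y) w \<bullet> i) *\<^sub>R form_comp B \<omega> d (\<phi> y) i) T"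
      by (rule Ck_on_cong[OF T eq])
    ultimately have "Ck_on k (\<lambda>x. form_comp A ?P c x w) T" by (rule iffD2[rotated])
    moreover have "x \<in> T" using p d(2) by (auto simp: T_def)
    ultimately show "\<exists>T. open T \<and> x \<in> T \<and> Ck_on k (\<lambda>x. form_comp A ?P c x w) T"
      using T by blast
  qed
  show ?thesis
    using lin smooth by (auto simp: one_forms_on_def smooth_on_def pullback_form_def)
qed

text \<open>The product rule for \<open>\<beta> y = a (\<phi> y) (D\<phi>(y) w)\<close>, the coordinate expression of a pullback evaluated at
  a constant vector \<open>w\<close>. After antisymmetrising in \<open>v\<close> and \<open>w\<close>, the first term becomes the exterior
  derivative of \<open>a\<close>, and the second one vanishes by the symmetry of second derivatives.\<close>

lemma frechet_derivative_pullback: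
  fixes a :: "'e::euclidean_space \<Rightarrow> 'e \<Rightarrow> real" and \<phi> :: "'d::euclidean_space \<Rightarrow> 'e"
  assumes S: "open S" "x \<in> S" and V: "open V" "\<phi> ` S \<subseteq> V"
    and d\<phi>: "\<phi> differentiable (at x)" and dd\<phi>: "(\<lambda>y. frechet_derivative \<phi> (at y) w) differentiable (at x)"
    and lin: "\<And>y. y \<in> V \<Longrightarrow> linear (a y)"
    and da: "\<And>i. (\<lambda>y. a y i) differentiable (at (\<phi> x))"
    and \<beta>: "\<And>y. y \<in> S \<Longrightarrow> \<beta> y = a (\<phi> y) (frechet_derivative \<phi> (at y) w)"
  shows "frechet_derivative \<beta> (at x) v =
    frechet_derivative (\<lambda>y. a y (frechet_derivative \<phi> (at x) w)) (at (\<phi> x)) (frechet_derivative \<phi> (at x) v) +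
    a (\<phi> x) (frechet_derivative (\<lambda>y. frechet_derivative \<phi> (at y) w) (at x) v)"
proof -
  define D where "D = frechet_derivative \<phi> (at x)"
  define H where "H = frechet_derivative (\<lambda>y. frechet_derivative \<phi> (at y) w) (at x)"
  define a' where "a' = (\<lambda>i. frechet_derivative (\<lambda>y. a y i) (at (\<phi> x)))"
  have \<phi>x: "\<phi> x \<in> V" using V(2) S(2) by auto
  have D: "(\<phi> has_derivative D) (at x)"
    using d\<phi> by (simp add: D_def frechet_derivative_works[symmetric])
  have H: "((\<lambda>y. frechet_derivative \<phi> (at y) w) has_derivative H) (at x)"
    using dd\<phi> by (simp add: H_def frechet_derivative_works[symmetric])
  have a': "((\<lambda>y. a y i) has_derivative a' i) (at (\<phi> x))" for i
    using da by (simp add: a'_def frechet_derivative_works[symmetric])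
  have a'\<phi>: "((\<lambda>y. a (\<phi> y) i) has_derivative (\<lambda>v. a' i (D v))) (at x)" for i
    using diff_chain_at[OF D a'] by (simp add: o_def)
  \<comment> \<open>Expanding \<open>a (\<phi> y)\<close> in the standard basis separates its two arguments, so that differentiability
    of each component \<open>a y i\<close> in \<open>y\<close> suffices.\<close>
  have "((\<lambda>y. \<Sum>i\<in>Basis. (frechet_derivative \<phi> (at y) w \<bullet> i) * a (\<phi> y) i) has_derivative
      (\<lambda>v. \<Sum>i\<in>Basis. (D w \<bullet> i) * a' i (D v) + (H v \<bullet> i) * a (\<phi> x) i)) (at x)"
    using H a'\<phi> unfolding D_def
    by (intro has_derivative_sum has_derivative_mult has_derivative_inner_left)
  then have "(\<beta> has_derivative
      (\<lambda>v. \<Sum>i\<in>Basis. (D w \<bullet> i) * a' i (D v) + (H v \<bullet> i) * a (\<phi> x) i)) (at x)"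
  proof (rule has_derivative_transform_within_open[OF _ S])
    fix y assume "y \<in> S"
    then have "\<phi> y \<in> V" using V(2) by auto
    from linear_eq_sum_Basis[OF lin[OF this], of "frechet_derivative \<phi> (at y) w"]
    show "(\<Sum>i\<in>Basis. (frechet_derivative \<phi> (at y) w \<bullet> i) * a (\<phi> y) i) = \<beta> y"
      unfolding \<beta>[OF \<open>y \<in> S\<close>] by (simp only: real_scaleR_def)
  qed
  from fun_cong[OF frechet_derivative_at[OF this], of v]
  have "frechet_derivative \<beta> (at x) v = (\<Sum>i\<in>Basis. (D w \<bullet> i) * a' i (D v)) + (\<Sum>i\<in>Basis. (H v \<bullet> i) * a (\<phi> x) i)"
    by (simp add: sum.distrib)
  also have "(\<Sum>i\<in>Basis. (H v \<bullet> i) * a (\<phi> x) i) = a (\<phi> x) (H v)"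
    using linear_eq_sum_Basis[OF lin[OF \<phi>x], of "H v"] by (simp only: real_scaleR_def)
  also have "(\<Sum>i\<in>Basis. (D w \<bullet> i) * a' i (D v)) = frechet_derivative (\<lambda>y. a y (D w)) (at (\<phi> x)) (D v)"
  proof -
    have "((\<lambda>y. \<Sum>i\<in>Basis. (D w \<bullet> i) * a y i) has_derivative
        (\<lambda>z. \<Sum>i\<in>Basis. (D w \<bullet> i) * a' i z)) (at (\<phi> x))"
      using a' by (intro has_derivative_sum has_derivative_mult_right)
    then have "((\<lambda>y. a y (D w)) has_derivative (\<lambda>z. \<Sum>i\<in>Basis. (D w \<bullet> i) * a' i z)) (at (\<phi> x))"
    proof (rule has_derivative_transform_within_open[OF _ V(1)])
      show "\<phi> x \<in> V" by (rule \<phi>x)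
      show "(\<Sum>i\<in>Basis. (D w \<bullet> i) * a y i) = a y (D w)" if "y \<in> V" for y
        using linear_eq_sum_Basis[OF lin[OF that], of "D w"] by (simp only: real_scaleR_def)
    qed
    from fun_cong[OF frechet_derivative_at[OF this], of "D v"] show ?thesis by simp
  qed
  finally show ?thesis by (simp add: D_def H_def)
qed

lemma pullback_in_closed_one_forms:
  fixes A :: "('a, 'e::euclidean_space) chart set" and B :: "('b, 'f::euclidean_space) chart set"
  assumes X: "smooth_manifold X A" and Y: "smooth_manifold Y B" and F: "smooth_map X A Y B F"
    and W: "openin Y W" "F ` topspace X \<subseteq> W" and \<omega>: "\<omega> \<in> closed_one_forms_on B W"
  shows "pullback_form X A B F \<omega> \<in> closed_one_forms_on A (topspace X)"
proof -
  let ?P = "pullback_form X A B F \<omega>"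
  have \<omega>1: "\<omega> \<in> one_forms_on B W" using \<omega> by (simp add: closed_one_forms_on_def)
  have "ext_deriv_comp A ?P c x v w = 0"
    if c: "c \<in> A" and x: "x \<in> snd c ` (fst c \<inter> topspace X)" for c x v w
  proof -
    obtain p where p: "p \<in> fst c" "p \<in> topspace X" "x = snd c p" using x by auto
    then have FpY: "F p \<in> topspace Y" using W openin_subset by blast
    define d where "d = chart_at B (F p)"
    note d = chart_at_chart[OF Y FpY, folded d_def]
    define T where "T = snd c ` {p \<in> fst c. F p \<in> fst d}"
    define V where "V = snd d ` (fst d \<inter> W)"
    define \<phi> where "\<phi> = snd d \<circ> F \<circ> chart_inv c"
    define a where "a = form_comp B \<omega> d"
    have T: "open T" unfolding T_def by (rule open_smooth_map_domain[OF X Y F c d(1)])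
    have V: "open V" unfolding V_def by (rule open_chart_image[OF Y d(1) W(1)])
    have xT: "x \<in> T" using p d(2) by (auto simp: T_def)
    have \<phi>: "smooth_on T \<phi>"
      unfolding T_def \<phi>_def by (rule smooth_map_local_smooth[OF F c d(1)])
    have "F q \<in> W" if "q \<in> fst c" for q
      using W(2) chart_domain_subset[OF X c] that by blast
    then have \<phi>T: "\<phi> ` T \<subseteq> V"
      by (auto simp: T_def V_def \<phi>_def chart_inv_chart[OF X c])
    have \<phi>x: "\<phi> x \<in> V" using \<phi>T xT by blast
    have lin: "linear (a y)" if "y \<in> V" for y
      using form_comp_linear[OF Y \<omega>1 d(1)] that by (simp add: a_def V_def)
    have da: "(\<lambda>y. a y i) differentiable (at (\<phi> x))" for i
      using \<omega>1 d(1) \<phi>x smooth_on_differentiable[of V "\<lambda>y. a y i" "\<phi> x"]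
      by (simp add: one_forms_on_def a_def V_def)
    have D: "frechet_derivative (\<lambda>y. form_comp A ?P c y w) (at x) v =
      frechet_derivative (\<lambda>y. a y (frechet_derivative \<phi> (at x) w)) (at (\<phi> x)) (frechet_derivative \<phi> (at x) v) +
      a (\<phi> x) (frechet_derivative (\<lambda>y. frechet_derivative \<phi> (at y) w) (at x) v)" for v w
    proof (rule frechet_derivative_pullback[OF T xT V \<phi>T _ _ lin da])
      show "\<phi> differentiable (at x)" by (rule smooth_on_differentiable[OF \<phi> xT])
      show "(\<lambda>y. frechet_derivative \<phi> (at y) w) differentiable (at x)"
        by (rule smooth_on_differentiable[OF smooth_on_frechet_derivative[OF \<phi>] xT])
      show "form_comp A ?P c y w = a (\<phi> y) (frechet_derivative \<phi> (at y) w)" if "y \<in> T" for y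
        unfolding \<phi>_def a_def by (rule form_comp_pullback[OF X Y F c d(1)]) (use that T_def in simp)
    qed
    have "frechet_derivative (\<lambda>y. frechet_derivative \<phi> (at y) w) (at x) v =
      frechet_derivative (\<lambda>y. frechet_derivative \<phi> (at y) v) (at x) w"
      using \<phi> by (intro mixed_derivatives_commute[OF T xT]) (simp add: smooth_on_def)
    moreover have "ext_deriv_comp B \<omega> d (\<phi> x) (frechet_derivative \<phi> (at x) v) (frechet_derivative \<phi> (at x) w) = 0"
      using \<omega> d(1) \<phi>x unfolding closed_one_forms_on_def V_def by blast
    ultimately show ?thesis by (simp add: ext_deriv_comp_def D a_def)
  qed
  then show ?thesis
    using pullback_in_one_forms[OF X Y F W \<omega>1] by (simp add: closed_one_forms_on_def)
qed

section \<open>Zeros of closed one-forms on compact manifolds\<close>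

lemma smooth_function_continuous:
  assumes X: "smooth_manifold X A" and f: "smooth_function X A f"
  shows "continuous_map X euclideanreal f"
proof (rule pasting_lemma[where T = fst and f = "\<lambda>_. f" and I = A])
  fix c assume c: "c \<in> A"
  have ch: "openin X (fst c)" "homeomorphic_map (subtopology X (fst c)) (top_of_set (snd c ` fst c)) (snd c)"
    using smooth_manifold_is_chart[OF X c] by (simp_all add: is_chart_def)
  show "openin X (fst c)" by (rule ch(1))
  have "Ck_on 0 (f \<circ> chart_inv c) (snd c ` fst c)"
    using f c unfolding smooth_function_def smooth_on_def by blast
  then have "continuous_map (top_of_set (snd c ` fst c)) euclideanreal (f \<circ> chart_inv c)" by simp
  from continuous_map_compose[OF homeomorphic_imp_continuous_map[OF ch(2)] this]
  show "continuous_map (subtopology X (fst c)) euclideanreal f"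
    by (rule continuous_map_eq) (simp add: chart_inv_chart[OF X c])
next
  show "\<exists>c. c \<in> A \<and> p \<in> fst c \<and> f p = f p" if "p \<in> topspace X" for p
    using chart_at_chart[OF X that] by blast
qed simp

lemma function_differential_at_max:
  assumes X: "smooth_manifold X A" and f: "smooth_function X A f"
    and p: "p \<in> topspace X" and max: "\<And>q. q \<in> topspace X \<Longrightarrow> f q \<le> f p"
  shows "function_differential X A f p v = 0"
proof -
  define c where "c = chart_at A p"
  note c = chart_at_chart[OF X p, folded c_def]
  let ?S = "snd c ` fst c"
  have "open ?S" using smooth_manifold_is_chart[OF X c(1)] by (simp add: is_chart_def)
  moreover have x: "snd c p \<in> ?S" using c(2) by simp
  moreover have "((f \<circ> chart_inv c) has_derivative frechet_derivative (f \<circ> chart_inv c) (at (snd c p)))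
      (at (snd c p))"
    using f c(1) x smooth_on_differentiable[of ?S "f \<circ> chart_inv c"]
    unfolding smooth_function_def frechet_derivative_works[symmetric] by blast
  moreover have "\<forall>y\<in>?S. (f \<circ> chart_inv c) y \<le> (f \<circ> chart_inv c) (snd c p)"
    using max chart_domain_subset[OF X c(1)] by (auto simp: chart_inv_chart[OF X c(1)] c(2))
  ultimately have "frechet_derivative (f \<circ> chart_inv c) (at (snd c p)) = (\<lambda>v. 0)"
    using differential_zero_maxmin[of "snd c p" ?S] by blast
  then show ?thesis by (simp add: function_differential_def Let_def c_def)
qed

text \<open>The class of a closed form \<open>\<omega>\<close> contains \<open>\<omega>\<close> itself, and it is the set of exact forms as this is the only
  element of \<open>H\<^sup>1\<close>. Reflexivity of the relation needs the zero form to be exact.\<close>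

lemma trivial_deRham_H1_exact:
  assumes H: "trivial_deRham_H1 X A" and \<omega>: "\<omega> \<in> closed_one_forms_on A (topspace X)"
  shows "\<omega> \<in> exact_one_forms X A"
proof -
  define R where "R = {(\<omega>, \<eta>). \<omega> \<in> closed_one_forms_on A (topspace X) \<and>
    \<eta> \<in> closed_one_forms_on A (topspace X) \<and> (\<lambda>p v. \<omega> p v - \<eta> p v) \<in> exact_one_forms X A}"
  have "smooth_function X A (\<lambda>_. 0)"
    by (simp add: smooth_function_def smooth_on_def o_def Ck_on_const)
  moreover have "(\<lambda>p v. 0) = function_differential X A (\<lambda>_. 0)"
    by (simp add: function_differential_def o_def Let_def fun_eq_iff)
  ultimately have "(\<lambda>p v. 0) \<in> exact_one_forms X A" unfolding exact_one_forms_def by blast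
  then have "\<omega> \<in> R `` {\<omega>}" using \<omega> by (simp add: R_def)
  moreover
  have "R `` {\<omega>} \<in> deRham_H1 X A"
    using \<omega> unfolding deRham_H1_def Let_def R_def[symmetric] by (rule quotientI)
  then have "R `` {\<omega>} = exact_one_forms X A"
    using H unfolding trivial_deRham_H1_def by (simp only: singleton_iff)
  ultimately show ?thesis by blast
qed

text \<open>As \<open>H\<^sup>1\<close> is trivial, a closed form is the differential of a function; it vanishes where that function is maximal.\<close>

lemma closed_one_form_vanishes_somewhere:
  assumes X: "smooth_manifold X A" and comp: "compact_space X" and ne: "topspace X \<noteq> {}"
    and H: "trivial_deRham_H1 X A" and \<omega>: "\<omega> \<in> closed_one_forms_on A (topspace X)"
  obtains p where "p \<in> topspace X" "\<And>v. \<omega> p v = 0"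
proof -
  obtain f where f: "smooth_function X A f" "\<omega> = function_differential X A f"
    using trivial_deRham_H1_exact[OF H \<omega>] unfolding exact_one_forms_def by blast
  have "compactin euclideanreal (f ` topspace X)"
    using comp smooth_function_continuous[OF X f(1)]
    by (intro image_compactin) (auto simp: compact_space_def)
  then have "compact (f ` topspace X)" by simp
  then obtain p where "p \<in> topspace X" "\<And>q. q \<in> topspace X \<Longrightarrow> f q \<le> f p"
    using compact_attains_sup[of "f ` topspace X"] ne by auto
  then show ?thesis using that function_differential_at_max[OF X f(1)] f(2) by blast
qed

section \<open>Lorentzian metrics and transverse vectors\<close>

text \<open>In the proof, the linear map \<open>T\<close> sends the standard basis to the components of the orthonormal frame. Pairing with the frame
  recovers the coordinates up to sign, so \<open>T\<close> is injective, hence surjective by dimension; this is why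
  the frame is a basis.\<close>

lemma lorentzian_metric_nondegenerate:
  fixes A :: "('a, 'e::euclidean_space) chart set"
  assumes X: "smooth_manifold X A" and g: "lorentzian_metric X A g" and p: "p \<in> topspace X"
    and v: "v \<in> tangent_space A p" and orth: "\<And>w. w \<in> tangent_space A p \<Longrightarrow> g p v w = 0"
  shows "v = tzero"
proof -
  define c where "c = chart_at A p"
  note c = chart_at_chart[OF X p, folded c_def]
  have lin: "linear_on_tangent A p (g p u)" if "u \<in> tangent_space A p" for u
    using g p that unfolding lorentzian_metric_def by blast
  have sym: "g p u w = g p w u" if "u \<in> tangent_space A p" "w \<in> tangent_space A p" for u w
    using g p that unfolding lorentzian_metric_def by blast
  have "\<exists>E. \<exists>t\<in>Basis. (\<forall>i\<in>Basis. E i \<in> tangent_space A p) \<and>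
      (\<forall>i\<in>(Basis :: 'e set). \<forall>j\<in>Basis.
        g p (E i) (E j) = (if i \<noteq> j then 0 else if i = t then -1 else 1))"
    using g p unfolding lorentzian_metric_def by blast
  then obtain E t where frame: "\<forall>i\<in>Basis. E i \<in> tangent_space A p"
    "\<forall>i\<in>(Basis :: 'e set). \<forall>j\<in>Basis.
        g p (E i) (E j) = (if i \<noteq> j then 0 else if i = t then -1 else 1)"
    by blast
  have E: "E i \<in> tangent_space A p" if "i \<in> Basis" for i
    using frame(1) that by blast
  define L where "L = (\<lambda>j w. g p (E j) (coord_vec A c p w))"
  define T where "T = (\<lambda>u::'e. \<Sum>i\<in>Basis. (u \<bullet> i) *\<^sub>R E i c)"
  have linL: "linear (L j)" if "j \<in> Basis" for j
    unfolding L_def by (rule linear_coord_comp[OF X c lin[OF E[OF that]]])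
  have LE: "L j (E i c) = (if i \<noteq> j then 0 else if i = t then -1 else 1)"
    if "i \<in> Basis" "j \<in> Basis" for i j
    using frame(2) that by (auto simp: L_def coord_vec_tangent[OF E[OF that(1)] c])
  have LT: "L j (T u) = (u \<bullet> j) * (if j = t then -1 else 1)" if "j \<in> Basis" for j u
  proof -
    have "L j (T u) = (\<Sum>i\<in>Basis. (u \<bullet> i) * L j (E i c))"
      by (simp add: T_def linear_sum[OF linL[OF that]] linear_scale[OF linL[OF that]])
    also have "\<dots> = (\<Sum>i\<in>Basis. if i = j then (u \<bullet> j) * (if j = t then -1 else 1) else 0)"
      using that by (intro sum.cong) (auto simp: LE)
    also have "\<dots> = (u \<bullet> j) * (if j = t then -1 else 1)"
      using that by (simp add: sum.delta)
    finally show ?thesis .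
  qed
  have zero: "u = 0" if "\<And>j. j \<in> Basis \<Longrightarrow> L j (T u) = 0" for u
  proof (rule euclidean_eqI)
    fix j :: 'e assume "j \<in> Basis"
    then show "u \<bullet> j = 0 \<bullet> j" using LT[of j u] that[of j] by (simp split: if_splits)
  qed
  have linT: "linear T"
    unfolding T_def by (intro linearI) (simp_all add: inner_add_left scaleR_add_left sum.distrib scaleR_sum_right)
  have "inj T"
  proof (rule linear_injective_0[OF linT, THEN iffD2], intro allI impI)
    fix u assume "T u = 0"
    then show "u = 0" using linear_0[OF linL] by (intro zero) simp
  qed
  then have "surj T" using linear_injective_imp_surjective[OF linT] by simp
  then obtain u where u: "v c = T u" by (metis surjD)
  have "u = 0"
  proof (rule zero)
    fix j :: 'e assume j: "j \<in> Basis"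
    show "L j (T u) = 0"
      unfolding u[symmetric] L_def coord_vec_tangent[OF v c] using orth[OF E[OF j]] sym[OF v E[OF j]] by simp
  qed
  then have "v c = 0" using u linear_0[OF linT] by simp
  then show ?thesis using coord_vec_tangent[OF v c] coord_vec_zero[OF X c] by simp
qed

text \<open>The tangent space of a hypersurface has codimension one, so together with any transverse vector \<open>z\<close>
  it spans the ambient tangent space. The statement is phrased for covectors: one that vanishes on both is zero.\<close>

lemma transverse_to_hypersurface_spans:
  fixes A :: "('a, 'e::euclidean_space) chart set" and B :: "('a, 'f::euclidean_space) chart set"
  assumes X: "smooth_manifold X A" and M: "hypersurface X A M B" and p: "p \<in> M"
    and h: "linear_on_tangent A p h"
    and sub: "\<And>u. u \<in> sub_tangent_space A B p \<Longrightarrow> h u = 0"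
    and z: "z \<in> tangent_space A p" "z \<notin> sub_tangent_space A B p" "h z = 0"
    and w: "w \<in> tangent_space A p"
  shows "h w = 0"
proof -
  let ?Y = "subtopology X M"
  have Y: "smooth_manifold ?Y B" and I: "smooth_map ?Y B X A (\<lambda>p. p)"
    and inj: "inj_on (map_differential B A (\<lambda>p. p) p) (tangent_space B p)"
    and dim: "DIM('e) = DIM('f) + 1" and MX: "M \<subseteq> topspace X"
    using M p by (auto simp: hypersurface_def)
  have pX: "p \<in> topspace X" "p \<in> topspace ?Y" using p MX by auto
  define c where "c = chart_at B p"
  define d where "d = chart_at A p"
  note c = chart_at_chart[OF Y pX(2), folded c_def]
  note d = chart_at_chart[OF X pX(1), folded d_def]
  define D where "D = frechet_derivative (snd d \<circ> (\<lambda>p. p) \<circ> chart_inv c) (at (snd c p))"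
  have linD: "linear D"
    unfolding D_def by (intro linear_frechet_derivative smooth_map_local_differentiable[OF I] c d)
  have mD: "map_differential B A (\<lambda>p. p) p (coord_vec B c p u) = coord_vec A d p (D u)" for u
    using map_differential_eq_coord_vec[OF Y X I coord_vec_in_tangent_space[OF Y c] c d]
    by (simp add: coord_vec_self[OF Y c] D_def)
  have subD: "coord_vec A d p (D u) \<in> sub_tangent_space A B p" for u
    unfolding sub_tangent_space_def mD[symmetric] using coord_vec_in_tangent_space[OF Y c] by blast
  have "inj D"
  proof (rule injI)
    fix u u' assume "D u = D u'"
    then have "coord_vec B c p u = coord_vec B c p u'"
      using inj_onD[OF inj] mD coord_vec_in_tangent_space[OF Y c] by metis
    then show "u = u'" using coord_vec_self[OF Y c] by metis
  qed
  then have "dim (range D) = DIM('f)"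
    using dim_image_eq[OF linD, of UNIV] by (simp add: inj_on_subset)
  moreover have "z d \<notin> span (range D)"
  proof
    assume "z d \<in> span (range D)"
    then obtain u where "z d = D u"
      using linear_span_image[OF linD, of UNIV] by auto
    then show False using subD[of u] coord_vec_tangent[OF z(1) d] z(2) by simp
  qed
  ultimately have "span (insert (z d) (range D)) = UNIV"
    using dim dim_eq_full[of "insert (z d) (range D)"] by (simp add: dim_insert)
  moreover have "h (coord_vec A d p y) = 0" if "y \<in> insert (z d) (range D)" for y
    using that sub[OF subD] z(3) coord_vec_tangent[OF z(1) d] by auto
  ultimately have "h (coord_vec A d p (w d)) = 0"
    using linear_eq_0_on_span[OF linear_coord_comp[OF X d h], of "insert (z d) (range D)"] by blast
  then show ?thesis using coord_vec_tangent[OF w d] by simp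
qed

section \<open>Nonexistence of closed riggings\<close>

theorem theorem3p1:
  fixes X :: "'a topology"
    and A :: "('a, 'e::euclidean_space) chart set"
    and g :: "('a, 'e) metric"
    and M :: "'a set"
    and B :: "('a, 'f::euclidean_space) chart set"
  assumes "lorentzian_manifold X A g"
    and "null_hypersurface X A g M B"
    and "M \<noteq> {}"
    and "compactin X M"
    and "trivial_deRham_H1 (subtopology X M) B"
  shows "\<not> (\<exists>W \<zeta>. closed_rigging X A g M B W \<zeta>)"
proof
  assume "\<exists>W \<zeta>. closed_rigging X A g M B W \<zeta>"
  then obtain W \<zeta> where rig: "rigging X A M B W \<zeta>"
    and closed: "metric_dual_form A g W \<zeta> \<in> closed_one_forms_on A W"
    by (auto simp: closed_rigging_def)
  let ?Y = "subtopology X M" and ?i = "\<lambda>p::'a. p"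
  let ?\<alpha> = "metric_dual_form A g W \<zeta>"
  have X: "smooth_manifold X A" and g: "lorentzian_metric X A g"
    using assms(1) by (auto simp: lorentzian_manifold_def)
  have hyp: "hypersurface X A M B" using assms(2) by (simp add: null_hypersurface_def)
  then have Y: "smooth_manifold ?Y B" and I: "smooth_map ?Y B X A ?i" and MX: "M \<subseteq> topspace X"
    by (auto simp: hypersurface_def)
  have W: "openin X W" "M \<subseteq> W" using rig by (auto simp: rigging_def)
  have topY: "topspace ?Y = M" using MX by auto
  have "pullback_form ?Y B A ?i ?\<alpha> \<in> closed_one_forms_on B (topspace ?Y)"
    using W MX by (intro pullback_in_closed_one_forms[OF Y X I W(1) _ closed]) auto
  then obtain p where p: "p \<in> M" and van: "\<And>v. pullback_form ?Y B A ?i ?\<alpha> p v = 0"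
    using closed_one_form_vanishes_somewhere[OF Y _ _ assms(5)] assms(3,4) topY
    by (metis compact_space_subtopology)
  have pX: "p \<in> topspace X" "p \<in> topspace ?Y" "p \<in> W" using p MX W by auto
  have sub: "u \<in> tangent_space A p" if "u \<in> sub_tangent_space A B p" for u
    using that map_differential_in_tangent_space[OF Y X I pX(2)] by (auto simp: sub_tangent_space_def)
  have \<zeta>: "\<zeta> p \<in> tangent_space A p" "\<zeta> p \<notin> sub_tangent_space A B p"
    using rig p pX by (auto simp: rigging_def smooth_vector_field_on_def)
  have \<zeta>_orth: "g p (\<zeta> p) u = 0" if u: "u \<in> sub_tangent_space A B p" for u
  proof -
    obtain v where v: "v \<in> tangent_space B p" "u = map_differential B A ?i p v"
      using u by (auto simp: sub_tangent_space_def)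
    have "pullback_form ?Y B A ?i ?\<alpha> p v = g p (\<zeta> p) u"
      using v pX sub[OF u] by (simp add: pullback_form_def metric_dual_form_def topY p)
    then show ?thesis using van by simp
  qed
  obtain v where v: "v \<in> sub_tangent_space A B p" "v \<noteq> tzero"
    and v_orth: "\<And>w. w \<in> sub_tangent_space A B p \<Longrightarrow> g p v w = 0"
    using assms(2) p unfolding null_hypersurface_def by blast
  have "linear_on_tangent A p (g p v)" "g p v (\<zeta> p) = g p (\<zeta> p) v"
    using g pX(1) sub[OF v(1)] \<zeta>(1) unfolding lorentzian_metric_def by blast+
  then have "g p v w = 0" if "w \<in> tangent_space A p" for w
    using transverse_to_hypersurface_spans[OF X hyp p _ v_orth \<zeta> _ that] \<zeta>_orth[OF v(1)] by simp
  then have "v = tzero"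
    by (rule lorentzian_metric_nondegenerate[OF X g pX(1) sub[OF v(1)]])
  with v(2) show False by simp
qed

end
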